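(* Let $n\ge 0$ be an integer. Then $D_n(1,x)$ is a permutation polynomial over $\mathbb{Z}_7$ if and only if $n$ is congruent to one of $2,3,9,14,15,21$ modulo $48$.
   Context: The $n$th reversed Dickson polynomial of the first kind (with parameter $1$) is the integer-coefficient polynomial $D_n(1,x)$ defined by $D_0(1,x)=2$, $D_1(1,x)=1$, $D_n(1,x)=D_{n-1}(1,x)-x\,D_{n-2}(1,x)$ for $n\ge 2$. A polynomial is a permutation polynomial over $\mathbb{Z}_7$ (the integers modulo $7$) if the map it induces $\mathbb{Z}_7\to\mathbb{Z}_7$ is a bijection. *)

theory Defs
  imports "HOL-Computational_Algebra.Polynomial"
begin

text \<open>The reversed Dickson polynomial of the first kind \<open>D\<^sub>n(1, x)\<close>; the linear
  polynomial \<open>[:0, 1:]\<close> is the indeterminate \<open>x\<close>.\<close>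

fun reversed_dickson :: "nat \<Rightarrow> int poly" where
  "reversed_dickson 0 = 2"
| "reversed_dickson (Suc 0) = 1"
| "reversed_dickson (Suc (Suc n)) = reversed_dickson (Suc n) - [:0, 1:] * reversed_dickson n"

text \<open>The integers modulo \<open>m\<close> are represented by the least non-negative residues
  \<open>{0..<m}\<close>, and the map induced by an integer polynomial is evaluation followed by
  reduction modulo \<open>m\<close>.\<close>

definition permutation_poly_mod :: "int \<Rightarrow> int poly \<Rightarrow> bool" where
  "permutation_poly_mod m f \<longleftrightarrow> bij_betw (\<lambda>a. poly f a mod m) {0..<m} {0..<m}"

end

theory Submission
  imports Defs "HOL-Number_Theory.Cong"
begin

text \<open>
  Put \<open>y (1 - y) = a\<close> with \<open>y\<close> in the field of 49 elements. Then
  \<open>D\<^sub>n(1, a) = y ^ n + (1 - y) ^ n\<close>, because \<open>y\<close> and \<open>1 - y\<close> are the roots of the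
  characteristic polynomial \<open>t\<^sup>2 - t + a\<close>. If \<open>a \<noteq> 0\<close>, both roots are nonzero and their
  48th powers are 1, so \<open>D\<^sub>n(1, a)\<close> depends only on \<open>n\<close> modulo 48. For \<open>a = 0\<close> the roots are
  0 and 1, and the value is 1 for all \<open>n \<ge> 1\<close>, but 2 for \<open>n = 0\<close>. Hence the induced
  map has period 48 from \<open>n = 1\<close> on, and not from \<open>n = 0\<close>.
  The six residues form the orbits \<open>{2, 14}\<close>, \<open>{3, 21}\<close> and \<open>{9, 15}\<close> of multiplication
  by 7, as they must come in such orbits: the Frobenius map gives \<open>D\<^sub>7\<^sub>n(1, a) = D\<^sub>n(1, a) ^ 7\<close>,
  which equals \<open>D\<^sub>n(1, a)\<close> in the prime field.

  The extension field can be avoided: a second-order recurrence is determined by two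
  consecutive values, so the period is certified by computing 50 terms modulo 7
  from \<open>D\<^sub>1 = 1\<close> and \<open>D\<^sub>2 = 1 - 2 a\<close> (lemma \<open>period_48\<close>). The same computation supplies the
  48 maps that have to be tested for injectivity (lemma \<open>injective_rows\<close>), and on a finite set
  injectivity is bijectivity. The constant \<open>D\<^sub>0 = 2\<close> is treated separately.
\<close>

fun recurrence_residues :: "int \<Rightarrow> nat \<Rightarrow> int \<Rightarrow> int \<Rightarrow> int list" where
  "recurrence_residues a 0 u v = []"
| "recurrence_residues a (Suc k) u v = u # recurrence_residues a k v ((v - a * u) mod 7)"

lemma recurrence_residues_dickson:
  "recurrence_residues a k (poly (reversed_dickson m) a mod 7)
      (poly (reversed_dickson (Suc m)) a mod 7)
    = map (\<lambda>i. poly (reversed_dickson i) a mod 7) [m..<m + k]"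
proof (induction k arbitrary: m)
  case (Suc k)
  have "[poly (reversed_dickson (Suc m)) a mod 7 - a * (poly (reversed_dickson m) a mod 7)
      = poly (reversed_dickson (Suc m)) a - a * poly (reversed_dickson m) a] (mod 7)"
    by (intro cong_diff cong_mult cong_refl) (simp_all add: cong_def)
  then have "(poly (reversed_dickson (Suc m)) a mod 7
        - a * (poly (reversed_dickson m) a mod 7)) mod 7
      = poly (reversed_dickson (Suc (Suc m))) a mod 7"
    by (simp add: cong_def)
  then show ?case
    using Suc.IH[of "Suc m"] by (simp add: upt_conv_Cons del: reversed_dickson.simps upt_Suc)
qed simp

text \<open>
  The list starts at \<open>D\<^sub>1\<close>, so position \<open>i\<close> belongs to index \<open>i + 1\<close>. Starting at \<open>D\<^sub>0\<close> would
  spoil the period at \<open>a = 0\<close>.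
\<close>

definition residues_from_1 :: "int \<Rightarrow> int list" where
  "residues_from_1 a = recurrence_residues a 50 1 ((1 - 2 * a) mod 7)"

lemma residues_from_1_eq_map:
  "residues_from_1 a = map (\<lambda>i. poly (reversed_dickson i) a mod 7) [1..<51]"
proof -
  have "poly (reversed_dickson (Suc (Suc 0))) a = 1 - 2 * a"
    by simp
  then show ?thesis
    using recurrence_residues_dickson[of a 50 1] by (simp add: residues_from_1_def mult.commute)
qed

lemma length_residues_from_1: "length (residues_from_1 a) = 50"
  by (simp add: residues_from_1_eq_map del: upt_Suc)

lemma nth_residues_from_1:
  assumes "i < 50"
  shows "residues_from_1 a ! i = poly (reversed_dickson (Suc i)) a mod 7"
  using assms by (simp add: residues_from_1_eq_map del: reversed_dickson.simps upt_Suc)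

text \<open>
  The two computations are equations between closed lists, without a variable for the argument
  or the index: rewriting under a binder would unfold the recurrence 50 times for a symbolic
  argument, where no residue can be reduced. Each table lists the values at one argument;
  transposing turns this into one row per index, which is the value list of an induced map.
\<close>

lemma residue_tables_repeat:
  "map (drop 48) (map residues_from_1 [0..6]) = map (take 2) (map residues_from_1 [0..6])"
  by code_simp

lemma injective_rows:
  "map distinct (transpose (map residues_from_1 [0..6]))
    = map (\<lambda>n. n mod 48 \<in> {2, 3, 9, 14, 15, 21}) [1..<51]"
  by code_simp

lemma distinct_row_iff:
  assumes "i < 50"
  shows "distinct (map (\<lambda>a. residues_from_1 a ! i) [0..6])
    \<longleftrightarrow> Suc i mod 48 \<in> {2, 3, 9, 14, 15, 21}"
proof -
  let ?tables = "map residues_from_1 [0..6]"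
  have "length (transpose ?tables) = 50"
    using arg_cong[OF injective_rows, of length] by (simp del: upt_Suc)
  then have "transpose ?tables ! i = map (\<lambda>a. residues_from_1 a ! i) [0..6]"
    and "distinct (transpose ?tables ! i) \<longleftrightarrow> map distinct (transpose ?tables) ! i"
    using assms by (simp_all add: nth_transpose filter_map o_def length_residues_from_1)
  then show ?thesis
    unfolding injective_rows using assms by (simp del: upt_Suc)
qed

lemma residues_from_1_repeat:
  assumes "a \<in> {0..<7}" and "i < 2"
  shows "residues_from_1 a ! (48 + i) = residues_from_1 a ! i"
proof -
  have "drop 48 (residues_from_1 a) = take 2 (residues_from_1 a)"
    using residue_tables_repeat assms(1) by (simp only: map_map map_eq_conv) auto
  then have "drop 48 (residues_from_1 a) ! i = take 2 (residues_from_1 a) ! i"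
    by simp
  then show ?thesis
    using assms(2) by (simp add: length_residues_from_1)
qed

lemma period_48:
  assumes "a \<in> {0..<7}"
  shows "poly (reversed_dickson (Suc m + 48)) a mod 7 = poly (reversed_dickson (Suc m)) a mod 7"
proof (induction m rule: induct_nat_012)
  case 0
  show ?case
    using residues_from_1_repeat[OF assms, of 0] nth_residues_from_1[of 48 a]
      nth_residues_from_1[of 0 a]
    by (simp del: reversed_dickson.simps)
next
  case 1
  show ?case
    using residues_from_1_repeat[OF assms, of 1] nth_residues_from_1[of 49 a]
      nth_residues_from_1[of 1 a]
    by (simp del: reversed_dickson.simps)
next
  case (ge2 m)
  have step: "poly (reversed_dickson (Suc (Suc k))) a
      = poly (reversed_dickson (Suc k)) a - a * poly (reversed_dickson k) a" for k
    by simp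
  have "[poly (reversed_dickson (Suc (Suc (Suc m + 48)))) a
      = poly (reversed_dickson (Suc (Suc (Suc m)))) a] (mod 7)"
    unfolding step using ge2
    by (intro cong_diff cong_mult cong_refl) (simp_all add: cong_def)
  then show ?case
    by (simp add: cong_def del: reversed_dickson.simps)
qed

lemma period_48_multiple:
  assumes "a \<in> {0..<7}"
  shows "poly (reversed_dickson (Suc (m + 48 * q))) a mod 7 = poly (reversed_dickson (Suc m)) a mod 7"
proof (induction q)
  case (Suc q)
  then show ?case
    using period_48[OF assms, of "m + 48 * q"]
    by (simp add: algebra_simps del: reversed_dickson.simps)
qed simp

lemma permutation_poly_mod_7_iff_distinct:
  "permutation_poly_mod 7 f \<longleftrightarrow> distinct (map (\<lambda>a. poly f a mod 7) [0..6])"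
proof -
  have "(\<lambda>a. poly f a mod 7) ` {0..<7} \<subseteq> {0..<7}"
    by auto
  then have "permutation_poly_mod 7 f \<longleftrightarrow> inj_on (\<lambda>a. poly f a mod 7) {0..<7}"
    unfolding permutation_poly_mod_def bij_betw_def
    using endo_inj_surj[of "{0..<7::int}"] by auto
  also have "{0..<7} = set [0..6::int]"
    by auto
  finally show ?thesis
    by (simp only: distinct_map) simp
qed

theorem theorem6p1:
  fixes n :: nat
  shows "permutation_poly_mod 7 (reversed_dickson n) \<longleftrightarrow> n mod 48 \<in> {2, 3, 9, 14, 15, 21}"
proof (cases n)
  case 0
  have "\<not> distinct (map (\<lambda>a::int. (2::int) mod 7) [0..6])"
    by code_simp
  with 0 show ?thesis
    by (simp add: permutation_poly_mod_7_iff_distinct)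
next
  case (Suc k)
  define i where "i = k mod 48"
  have i: "i < 48" and k: "k = i + 48 * (k div 48)"
    by (simp_all add: i_def)
  have "poly (reversed_dickson n) a mod 7 = residues_from_1 a ! i" if "a \<in> set [0..6]" for a
    using that i period_48_multiple[of a i "k div 48"] nth_residues_from_1[of i a]
    by (simp add: Suc k[symmetric] del: reversed_dickson.simps)
  then have "permutation_poly_mod 7 (reversed_dickson n)
      \<longleftrightarrow> distinct (map (\<lambda>a. residues_from_1 a ! i) [0..6])"
    unfolding permutation_poly_mod_7_iff_distinct by (metis (no_types, lifting) map_cong)
  also have "\<dots> \<longleftrightarrow> Suc i mod 48 \<in> {2, 3, 9, 14, 15, 21}"
    using distinct_row_iff[of i] i by simp
  also have "Suc i mod 48 = n mod 48"
    unfolding Suc i_def by (simp add: mod_Suc_eq)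
  finally show ?thesis .
qed

end
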